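(* Let $R$ be a commutative ring with unit. If $G$ is a totally ordered monoid (not necessarily commutative), then under the natural addition and multiplication, the set $R_w[G]$ of Malcev-Neumann series on $G$ with coefficients in $R$ is a ring.
   Context: A totally ordered monoid is a monoid $G$ with a total ordering $\le$ such that $x<y$ implies $zx<zy$ and $xz<yz$ for all $x,y,z\in G$. A Malcev-Neumann series is a formal series $\eta=\sum_{g\in G}a_gg$ with $a_g\in R$ whose support $\{g\in G:a_g\neq0\}$ is a well-ordered subset of $G$ (every nonempty subset has a least element). Addition is coefficientwise, and multiplication extends that of $G$ linearly. *)

theory Defs
  imports "HOL-Algebra.Ring" "HOL-Library.FuncSet" "HOL.Order_Relation"
begin

text \<open>The order is a relation on the carrier, \<open>(x, y) \<in> leq\<close> meaning \<open>x \<le> y\<close>.\<close>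

locale totally_ordered_monoid = monoid G for G :: "('g, 'm) monoid_scheme" (structure) +
  fixes leq :: "'g rel"
  assumes total_order: "linear_order_on (carrier G) leq"
    and mult_strict_mono:
      "\<lbrakk>x \<in> carrier G; y \<in> carrier G; z \<in> carrier G; (x, y) \<in> leq; x \<noteq> y\<rbrakk> \<Longrightarrow>
        ((z \<otimes> x, z \<otimes> y) \<in> leq \<and> z \<otimes> x \<noteq> z \<otimes> y) \<and>
        ((x \<otimes> z, y \<otimes> z) \<in> leq \<and> x \<otimes> z \<noteq> y \<otimes> z)"

definition well_ordered_subset :: "'g rel \<Rightarrow> 'g set \<Rightarrow> bool" where
  "well_ordered_subset leq S \<longleftrightarrow>
     (\<forall>T. T \<subseteq> S \<and> T \<noteq> {} \<longrightarrow> (\<exists>m\<in>T. \<forall>x\<in>T. (m, x) \<in> leq))"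

text \<open>
  A formal series is its family of coefficients, an extensional function on the carrier of
  the monoid, so that equality of series is equality of all coefficients.
\<close>

definition series_support ::
  "('r, 'k) ring_scheme \<Rightarrow> ('g, 'm) monoid_scheme \<Rightarrow> ('g \<Rightarrow> 'r) \<Rightarrow> 'g set" where
  "series_support R G a = {g \<in> carrier G. a g \<noteq> \<zero>\<^bsub>R\<^esub>}"

definition MN_series ::
  "('r, 'k) ring_scheme \<Rightarrow> ('g, 'm) monoid_scheme \<Rightarrow> 'g rel \<Rightarrow> ('g \<Rightarrow> 'r) set" where
  "MN_series R G leq =
     {a \<in> carrier G \<rightarrow>\<^sub>E carrier R. well_ordered_subset leq (series_support R G a)}"

text \<open>
  The pairs that contribute to the coefficient of \<open>g\<close> in the product of \<open>a\<close> and \<open>b\<close>. Since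
  \<open>finsum\<close> over an infinite set is zero by convention, the product below is the intended one
  only where these sets are finite.
\<close>

definition factor_pairs ::
  "('r, 'k) ring_scheme \<Rightarrow> ('g, 'm) monoid_scheme \<Rightarrow> ('g \<Rightarrow> 'r) \<Rightarrow> ('g \<Rightarrow> 'r) \<Rightarrow> 'g \<Rightarrow>
     ('g \<times> 'g) set" where
  "factor_pairs R G a b g =
     {(x, y) \<in> series_support R G a \<times> series_support R G b. x \<otimes>\<^bsub>G\<^esub> y = g}"

definition MN_ring ::
  "('r, 'k) ring_scheme \<Rightarrow> ('g, 'm) monoid_scheme \<Rightarrow> 'g rel \<Rightarrow> ('g \<Rightarrow> 'r) ring" where
  "MN_ring R G leq =
     \<lparr>carrier = MN_series R G leq,
      monoid.mult = (\<lambda>a b. \<lambda>g\<in>carrier G.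
        \<Oplus>\<^bsub>R\<^esub>p\<in>factor_pairs R G a b g. a (fst p) \<otimes>\<^bsub>R\<^esub> b (snd p)),
      one = (\<lambda>g\<in>carrier G. if g = \<one>\<^bsub>G\<^esub> then \<one>\<^bsub>R\<^esub> else \<zero>\<^bsub>R\<^esub>),
      zero = (\<lambda>g\<in>carrier G. \<zero>\<^bsub>R\<^esub>),
      add = (\<lambda>a b. \<lambda>g\<in>carrier G. a g \<oplus>\<^bsub>R\<^esub> b g)\<rparr>"

end

theory Submission
  imports Defs "HOL-Algebra.Coset"
begin

text \<open>
  In a product of two well-ordered sets, any nonempty family of factorizations contains one with
  least product; hence products of well-ordered sets are well-ordered. A fibre of the
  multiplication on such a product is finite, because its set of first coordinates is well-ordered
  for both the order and its reverse. The coefficient of a product may then be computed over any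
  finite set of factorizations that contains the factor pairs, and the ring axioms reduce to
  rearranging finite sums.
\<close>

section \<open>Iterated finite sums\<close>

lemma (in abelian_monoid) finsum_Sigma:
  assumes "finite I" "\<And>i. i \<in> I \<Longrightarrow> finite (A i)"
    and f: "\<And>i x. i \<in> I \<Longrightarrow> x \<in> A i \<Longrightarrow> f i x \<in> carrier G"
  shows "(\<Oplus>i\<in>I. \<Oplus>x\<in>A i. f i x) = (\<Oplus>p\<in>Sigma I A. f (fst p) (snd p))"
proof -
  have "Sigma I A = (\<Union>i\<in>I. Pair i ` A i)"
    by auto
  also have "(\<Oplus>p\<in>\<dots>. f (fst p) (snd p)) = (\<Oplus>i\<in>I. \<Oplus>p\<in>Pair i ` A i. f (fst p) (snd p))"
    using assms by (intro add.finprod_UN_disjoint) (auto simp: pairwise_def disjnt_def)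
  also have "\<dots> = (\<Oplus>i\<in>I. \<Oplus>x\<in>A i. f i x)"
  proof (rule finsum_cong')
    show "(\<Oplus>p\<in>Pair i ` A i. f (fst p) (snd p)) = (\<Oplus>x\<in>A i. f i x)" if "i \<in> I" for i
      using f[OF that] by (subst finsum_reindex) (auto intro: inj_onI)
    show "(\<lambda>i. \<Oplus>x\<in>A i. f i x) \<in> I \<rightarrow> carrier G"
      using f by (auto intro!: finsum_closed)
  qed simp
  finally show ?thesis ..
qed

section \<open>Well-ordered subsets of a totally ordered monoid\<close>

lemma well_ordered_subset_mono:
  "well_ordered_subset leq S \<Longrightarrow> T \<subseteq> S \<Longrightarrow> well_ordered_subset leq T"
  unfolding well_ordered_subset_def by (meson subset_trans)

lemma well_ordered_subset_minimum:
  assumes "well_ordered_subset leq S" "T \<subseteq> S" "T \<noteq> {}"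
  obtains m where "m \<in> T" "\<And>x. x \<in> T \<Longrightarrow> (m, x) \<in> leq"
proof -
  have "\<exists>m\<in>T. \<forall>x\<in>T. (m, x) \<in> leq"
    using assms by (simp add: well_ordered_subset_def)
  then show thesis
    using that by auto
qed

context totally_ordered_monoid
begin

lemma leq_carrier: "(x, y) \<in> leq \<Longrightarrow> x \<in> carrier G \<and> y \<in> carrier G"
  using total_order by (auto simp: order_on_defs)

lemma leq_refl: "x \<in> carrier G \<Longrightarrow> (x, x) \<in> leq"
  using total_order by (auto simp: order_on_defs refl_on_def)

lemma leq_trans: "(x, y) \<in> leq \<Longrightarrow> (y, z) \<in> leq \<Longrightarrow> (x, z) \<in> leq"
  using total_order unfolding order_on_defs by (meson transD)

lemma leq_antisym: "(x, y) \<in> leq \<Longrightarrow> (y, x) \<in> leq \<Longrightarrow> x = y"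
  using total_order unfolding order_on_defs by (meson antisymD)

lemma leq_total: "x \<in> carrier G \<Longrightarrow> y \<in> carrier G \<Longrightarrow> (x, y) \<in> leq \<or> (y, x) \<in> leq"
  using total_order leq_refl by (cases "x = y") (auto simp: order_on_defs total_on_def)

text \<open>One factor is changed at a time; each change is either trivial or an instance of strict
  monotonicity.\<close>

lemma mult_mono:
  assumes "(x, x') \<in> leq" "(y, y') \<in> leq"
  shows "(x \<otimes> y, x' \<otimes> y') \<in> leq"
proof -
  have "(x \<otimes> y, x' \<otimes> y) \<in> leq"
    using assms leq_carrier leq_refl mult_strict_mono[of x x' y] by (cases "x = x'") auto
  moreover have "(x' \<otimes> y, x' \<otimes> y') \<in> leq"
    using assms leq_carrier leq_refl mult_strict_mono[of y y' x'] by (cases "y = y'") auto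
  ultimately show ?thesis
    by (rule leq_trans)
qed

text \<open>Distinct factors are comparable by totality, and strict monotonicity then keeps their
  products apart.\<close>

lemma mult_left_cancel:
  "\<lbrakk>x \<in> carrier G; y \<in> carrier G; z \<in> carrier G; z \<otimes> x = z \<otimes> y\<rbrakk> \<Longrightarrow> x = y"
  using leq_total mult_strict_mono by metis

text \<open>The least element of \<open>{x}\<close> gives \<open>(x, x) \<in> leq\<close>, and
  \<open>leq\<close> relates only elements of the carrier.\<close>

lemma well_ordered_subset_carrier: "well_ordered_subset leq S \<Longrightarrow> S \<subseteq> carrier G"
proof
  fix x assume "well_ordered_subset leq S" "x \<in> S"
  then show "x \<in> carrier G"
    using leq_carrier by (auto elim: well_ordered_subset_minimum[of leq S "{x}"])
qed

lemma well_ordered_subset_empty: "well_ordered_subset leq {}"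
  by (auto simp: well_ordered_subset_def)

lemma well_ordered_subset_singleton: "x \<in> carrier G \<Longrightarrow> well_ordered_subset leq {x}"
  using leq_refl by (auto simp: well_ordered_subset_def subset_singleton_iff)

lemma well_ordered_subset_Un:
  assumes A: "well_ordered_subset leq A" and B: "well_ordered_subset leq B"
  shows "well_ordered_subset leq (A \<union> B)"
  unfolding well_ordered_subset_def
proof (intro allI impI)
  fix T assume T: "T \<subseteq> A \<union> B \<and> T \<noteq> {}"
  show "\<exists>m\<in>T. \<forall>x\<in>T. (m, x) \<in> leq"
  proof (cases "T \<inter> A = {} \<or> T \<inter> B = {}")
    case True
    then have "T \<subseteq> A \<or> T \<subseteq> B"
      using T by auto
    then show ?thesis
      using T A B unfolding well_ordered_subset_def by blast
  next
    case False
    obtain m where m: "m \<in> T \<inter> A" "\<And>x. x \<in> T \<inter> A \<Longrightarrow> (m, x) \<in> leq"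
      using well_ordered_subset_minimum[OF A, of "T \<inter> A"] False by blast
    obtain n where n: "n \<in> T \<inter> B" "\<And>x. x \<in> T \<inter> B \<Longrightarrow> (n, x) \<in> leq"
      using well_ordered_subset_minimum[OF B, of "T \<inter> B"] False by blast
    have "(m, n) \<in> leq \<or> (n, m) \<in> leq"
      using m n leq_total leq_carrier by blast
    then show ?thesis
    proof
      assume "(m, n) \<in> leq"
      then have "(m, x) \<in> leq" if "x \<in> T" for x
        using that T m(2)[of x] n(2)[of x] leq_trans[of m n x] by auto
      then show ?thesis
        using m(1) by auto
    next
      assume "(n, m) \<in> leq"
      then have "(n, x) \<in> leq" if "x \<in> T" for x
        using that T m(2)[of x] n(2)[of x] leq_trans[of n m x] by auto
      then show ?thesis
        using n(1) by auto
    qed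
  qed
qed

section \<open>Products of well-ordered sets\<close>

text \<open>
  Call a pair good if every pair of smaller product has smaller first coordinate. Among the
  pairs of any nonempty initial segment, one with least second coordinate is good; so a good pair
  with least first coordinate has least product.
\<close>

lemma least_product:
  assumes A: "well_ordered_subset leq A" and B: "well_ordered_subset leq B"
    and P: "P \<subseteq> A \<times> B" "P \<noteq> {}"
  obtains c d where "(c, d) \<in> P" "\<And>x y. (x, y) \<in> P \<Longrightarrow> (c \<otimes> d, x \<otimes> y) \<in> leq"
proof -
  have carrier: "x \<in> carrier G \<and> y \<in> carrier G" if "(x, y) \<in> P" for x y
    using that P A B well_ordered_subset_carrier by blast
  \<comment> \<open>Non-membership in \<open>leq\<close> plays the role of the strict order: for
    elements of the carrier, \<open>(u, v) \<notin> leq\<close> means that v is strictly below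
    u.\<close>
  define good where "good = (\<lambda>(c, d). (c, d) \<in> P \<and>
    (\<forall>(x, y)\<in>P. (c \<otimes> d, x \<otimes> y) \<notin> leq \<longrightarrow> (c, x) \<notin> leq))"
  have ex_good: "\<exists>c d. (c, d) \<in> Q \<and> good (c, d)"
    if Q: "Q \<subseteq> P" "Q \<noteq> {}"
      and initial: "\<And>x y c d. \<lbrakk>(x, y) \<in> P; (c, d) \<in> Q; (c \<otimes> d, x \<otimes> y) \<notin> leq\<rbrakk> \<Longrightarrow> (x, y) \<in> Q"
    for Q
  proof -
    have "snd ` Q \<subseteq> B" "snd ` Q \<noteq> {}"
      using Q P by auto
    then obtain d where "d \<in> snd ` Q" and least: "\<And>y. y \<in> snd ` Q \<Longrightarrow> (d, y) \<in> leq"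
      using well_ordered_subset_minimum[OF B] by metis
    then obtain c where cd: "(c, d) \<in> Q"
      by auto
    \<comment> \<open>The pair \<open>(x, y)\<close> lies in \<open>Q\<close> by
      \<open>initial\<close>, so d \<le> y. If also c \<le> x, monotonicity would make the product
      of \<open>(c, d)\<close> at most that of \<open>(x, y)\<close>.\<close>
    have "(c, x) \<notin> leq" if "(x, y) \<in> P" "(c \<otimes> d, x \<otimes> y) \<notin> leq" for x y
    proof -
      have "(d, y) \<in> leq"
        using initial[OF that(1) cd that(2)] least by force
      then show ?thesis
        using that mult_mono by blast
    qed
    then have "good (c, d)"
      using cd Q by (auto simp: good_def)
    then show ?thesis
      using cd by blast
  qed
  define C where "C = {c. \<exists>d. good (c, d)}"
  have "C \<subseteq> A"
    using P by (auto simp: C_def good_def)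
  moreover have "C \<noteq> {}"
    using ex_good[of P] P by (auto simp: C_def)
  ultimately obtain c where "c \<in> C" and least: "\<And>x. x \<in> C \<Longrightarrow> (c, x) \<in> leq"
    using well_ordered_subset_minimum[OF A] by metis
  then obtain d where cd: "good (c, d)"
    by (auto simp: C_def)
  \<comment> \<open>These pairs would refute minimality of the product of \<open>(c, d)\<close>.
    They form an initial segment, so if there were any, one of them, \<open>(u, v)\<close>, would be
    good. Then c \<le> u by the choice of c, while goodness of \<open>(c, d)\<close> forbids
    this.\<close>
  define Q where "Q = {(x, y) \<in> P. (c \<otimes> d, x \<otimes> y) \<notin> leq}"
  have "Q = {}"
  proof (rule ccontr)
    assume "Q \<noteq> {}"
    moreover have "(x, y) \<in> Q" if "(x, y) \<in> P" "(u, v) \<in> Q" "(u \<otimes> v, x \<otimes> y) \<notin> leq" for x y u v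
    proof -
      have "(x \<otimes> y, u \<otimes> v) \<in> leq"
        using that carrier leq_total unfolding Q_def by blast
      then show ?thesis
        using that leq_trans unfolding Q_def by blast
    qed
    ultimately obtain u v where uv: "(u, v) \<in> Q" "good (u, v)"
      using ex_good[of Q] by (auto simp: Q_def)
    then have "(c, u) \<in> leq"
      using least by (auto simp: C_def)
    then show False
      using cd uv(1) by (auto simp: Q_def good_def)
  qed
  then show thesis
    using that[of c d] cd by (auto simp: good_def Q_def)
qed

text \<open>A least element of \<open>T\<close> is found by applying \<open>least_product\<close> to
  all factorizations of elements of \<open>T\<close> at once.\<close>

lemma well_ordered_subset_set_mult:
  assumes A: "well_ordered_subset leq A" and B: "well_ordered_subset leq B"
  shows "well_ordered_subset leq (A <#> B)"
  unfolding well_ordered_subset_def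
proof (intro allI impI)
  fix T assume T: "T \<subseteq> A <#> B \<and> T \<noteq> {}"
  define P where "P = {(x, y) \<in> A \<times> B. x \<otimes> y \<in> T}"
  have "P \<noteq> {}"
    using T by (fastforce simp: P_def set_mult_def)
  then obtain c d where cd: "(c, d) \<in> P" "\<And>x y. (x, y) \<in> P \<Longrightarrow> (c \<otimes> d, x \<otimes> y) \<in> leq"
    using least_product[OF A B, of P] by (auto simp: P_def)
  have "(c \<otimes> d, t) \<in> leq" if "t \<in> T" for t
  proof -
    have "t \<in> A <#> B"
      using T that by blast
    then obtain x y where "x \<in> A" "y \<in> B" "t = x \<otimes> y"
      by (auto simp: set_mult_def)
    then show ?thesis
      using cd(2) that by (auto simp: P_def)
  qed
  then show "\<exists>m\<in>T. \<forall>x\<in>T. (m, x) \<in> leq"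
    using cd(1) by (auto simp: P_def)
qed

section \<open>Finiteness of the fibres of multiplication\<close>

text \<open>The set \<open>L\<close> of elements with finitely many predecessors contains the
  minimum of \<open>S\<close>, so it has a greatest element k. If \<open>S\<close> were infinite,
  some element would lie above k, and the least such element would again belong to
  \<open>L\<close>.\<close>

lemma finite_if_minima_and_maxima:
  assumes wo: "well_ordered_subset leq S"
    and max: "\<And>T. T \<subseteq> S \<Longrightarrow> T \<noteq> {} \<Longrightarrow> \<exists>m\<in>T. \<forall>x\<in>T. (x, m) \<in> leq"
  shows "finite S"
proof (rule ccontr)
  assume inf: "infinite S"
  then have "S \<noteq> {}"
    by auto
  define L where "L = {x \<in> S. finite {y \<in> S. (y, x) \<in> leq}}"
  obtain m where m: "m \<in> S" "\<And>x. x \<in> S \<Longrightarrow> (m, x) \<in> leq"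
    using well_ordered_subset_minimum[OF wo order.refl \<open>S \<noteq> {}\<close>] by blast
  have "{y \<in> S. (y, m) \<in> leq} \<subseteq> {m}"
    using m leq_antisym by blast
  then have "m \<in> L"
    using m finite_subset by (auto simp: L_def)
  then obtain k where k: "k \<in> L" "\<And>x. x \<in> L \<Longrightarrow> (x, k) \<in> leq"
    using max[of L] by (auto simp: L_def)
  define U where "U = {y \<in> S. (y, k) \<notin> leq}"
  have fin: "finite {y \<in> S. (y, k) \<in> leq}"
    using k by (simp add: L_def)
  have "S = {y \<in> S. (y, k) \<in> leq} \<union> U"
    by (auto simp: U_def)
  then have "U \<noteq> {}"
    using inf fin by (metis Un_empty_right)
  then obtain u where u: "u \<in> U" "\<And>x. x \<in> U \<Longrightarrow> (u, x) \<in> leq"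
    using well_ordered_subset_minimum[OF wo, of U] by (auto simp: U_def)
  \<comment> \<open>A predecessor of u that is not below k lies in \<open>U\<close>, hence is also
    above u and equals it.\<close>
  have "{y \<in> S. (y, u) \<in> leq} \<subseteq> insert u {y \<in> S. (y, k) \<in> leq}"
    using u leq_antisym by (auto simp: U_def)
  then have "u \<in> L"
    using u fin by (auto simp: L_def U_def intro: finite_subset)
  then show False
    using k u by (auto simp: U_def)
qed

text \<open>The sets are arbitrary rather than supports, so that coefficients of different products
  can be summed over a common index set.\<close>

definition factorizations :: "'g set \<Rightarrow> 'g set \<Rightarrow> 'g \<Rightarrow> ('g \<times> 'g) set" where
  "factorizations A B g = {(x, y) \<in> A \<times> B. x \<otimes> y = g}"

text \<open>Within a fibre, a larger first coordinate forces a smaller second one. Minima in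
  \<open>B\<close> therefore yield maxima among the first coordinates, whose minima come from
  \<open>A\<close>. Left cancellation shows that the first coordinate determines the pair.\<close>

lemma finite_factorizations:
  assumes A: "well_ordered_subset leq A" and B: "well_ordered_subset leq B"
  shows "finite (factorizations A B g)"
proof -
  let ?P = "factorizations A B g"
  have carrier: "x \<in> carrier G \<and> y \<in> carrier G \<and> x \<otimes> y = g" if "(x, y) \<in> ?P" for x y
    using that A B well_ordered_subset_carrier by (auto simp: factorizations_def)
  have "\<exists>m\<in>T. \<forall>x\<in>T. (x, m) \<in> leq" if T: "T \<subseteq> fst ` ?P" "T \<noteq> {}" for T
  proof -
    \<comment> \<open>The least second coordinate d belonging to a member of \<open>T\<close> has a
      partner c in \<open>T\<close>; this c is the greatest element of \<open>T\<close>.\<close>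
    define Y where "Y = {y. \<exists>x\<in>T. (x, y) \<in> ?P}"
    have "Y \<subseteq> B" "Y \<noteq> {}"
      using T by (fastforce simp: Y_def factorizations_def)+
    then obtain d where "d \<in> Y" and least: "\<And>y. y \<in> Y \<Longrightarrow> (d, y) \<in> leq"
      using well_ordered_subset_minimum[OF B] by metis
    then obtain c where c: "c \<in> T" "(c, d) \<in> ?P"
      by (auto simp: Y_def)
    have "(x, c) \<in> leq" if "x \<in> T" for x
    proof (rule ccontr)
      assume not_leq: "(x, c) \<notin> leq"
      have "x \<in> fst ` ?P"
        using that T by blast
      then obtain y where y: "(x, y) \<in> ?P"
        by auto
      then have dy: "(d, y) \<in> leq"
        using least that by (auto simp: Y_def)
      have cx: "(c, x) \<in> leq" "c \<noteq> x"
        using not_leq leq_total leq_refl carrier[OF y] carrier[OF c(2)] by blast+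
      \<comment> \<open>If c < x, then g = cd < xd \<le> xy = g, which is absurd.\<close>
      have "(c \<otimes> d, x \<otimes> d) \<in> leq \<and> c \<otimes> d \<noteq> x \<otimes> d"
        using mult_strict_mono cx carrier[OF y] carrier[OF c(2)] by blast
      moreover have "(x \<otimes> d, x \<otimes> y) \<in> leq"
        using mult_mono dy leq_refl carrier[OF y] by blast
      ultimately show False
        using carrier[OF y] carrier[OF c(2)] leq_antisym[of "x \<otimes> d" g] by simp
    qed
    then show ?thesis
      using c by blast
  qed
  moreover have "well_ordered_subset leq (fst ` ?P)"
    by (rule well_ordered_subset_mono[OF A]) (auto simp: factorizations_def)
  ultimately have "finite (fst ` ?P)"
    by (intro finite_if_minima_and_maxima)
  moreover have "inj_on fst ?P"
  proof (rule inj_onI)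
    fix p q assume pq: "p \<in> ?P" "q \<in> ?P" "fst p = fst q"
    obtain x y y' where "p = (x, y)" "q = (x, y')"
      using pq(3) by (cases p, cases q) auto
    then show "p = q"
      using carrier[of x y] carrier[of x y'] mult_left_cancel[of y y' x] pq by simp
  qed
  ultimately show ?thesis
    by (rule finite_imageD)
qed

end

section \<open>Series and the coefficients of their products\<close>

locale malcev_neumann = R: ring R + totally_ordered_monoid G leq
  for R :: "('r, 'k) ring_scheme" and G :: "('g, 'm) monoid_scheme" (structure) and leq
begin

abbreviation supp :: "('g \<Rightarrow> 'r) \<Rightarrow> 'g set" where
  "supp \<equiv> series_support R G"

abbreviation MN :: "('g \<Rightarrow> 'r) ring" where
  "MN \<equiv> MN_ring R G leq"

lemma carrier_MN: "carrier MN = MN_series R G leq"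
  by (simp add: MN_ring_def)

lemma MN_closed: "a \<in> carrier MN \<Longrightarrow> g \<in> carrier G \<Longrightarrow> a g \<in> carrier R"
  by (auto simp: carrier_MN MN_series_def)

lemma supp_carrier: "supp a \<subseteq> carrier G"
  by (auto simp: series_support_def)

lemma supp_well_ordered: "a \<in> carrier MN \<Longrightarrow> well_ordered_subset leq (supp a)"
  by (simp add: carrier_MN MN_series_def)

lemma zero_outside_supp: "g \<in> carrier G \<Longrightarrow> g \<notin> supp a \<Longrightarrow> a g = \<zero>\<^bsub>R\<^esub>"
  by (simp add: series_support_def)

lemma MN_eqI:
  assumes "a \<in> carrier MN" "b \<in> carrier MN" "\<And>g. g \<in> carrier G \<Longrightarrow> a g = b g"
  shows "a = b"
  using assms by (auto simp: carrier_MN MN_series_def intro: PiE_ext)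

text \<open>Cancellation can make the support of a sum or product smaller than expected. It is
  enough to bound it by a well-ordered set, since well-ordering passes to subsets.\<close>

lemma MN_memI:
  assumes "a \<in> carrier G \<rightarrow>\<^sub>E carrier R" "well_ordered_subset leq S"
    and "\<And>g. g \<in> carrier G \<Longrightarrow> g \<notin> S \<Longrightarrow> a g = \<zero>\<^bsub>R\<^esub>"
  shows "a \<in> carrier MN"
proof -
  have "supp a \<subseteq> S"
    using assms(3) by (auto simp: series_support_def)
  then show ?thesis
    using assms well_ordered_subset_mono by (auto simp: carrier_MN MN_series_def)
qed

lemma factor_pairs_eq: "factor_pairs R G a b g = factorizations (supp a) (supp b) g"
  by (simp add: factor_pairs_def factorizations_def)

lemma finite_factor_pairs:
  "a \<in> carrier MN \<Longrightarrow> b \<in> carrier MN \<Longrightarrow> finite (factor_pairs R G a b g)"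
  by (simp add: factor_pairs_eq finite_factorizations supp_well_ordered)

text \<open>An additional pair in \<open>F\<close> still multiplies to g, so it fails to be a factor
  pair only by leaving one of the supports, and its term vanishes. Keeping \<open>F\<close> inside
  the carrier avoids the undefined values of extensional functions.\<close>

lemma mult_apply_superset:
  assumes "a \<in> carrier MN" "b \<in> carrier MN" "g \<in> carrier G" "finite F"
    and F: "F \<subseteq> factorizations (carrier G) (carrier G) g" "factor_pairs R G a b g \<subseteq> F"
  shows "(a \<otimes>\<^bsub>MN\<^esub> b) g = (\<Oplus>\<^bsub>R\<^esub>p\<in>F. a (fst p) \<otimes>\<^bsub>R\<^esub> b (snd p))"
proof -
  have carrier: "fst p \<in> carrier G \<and> snd p \<in> carrier G" if "p \<in> F" for p
    using F that by (auto simp: factorizations_def)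
  have "(a \<otimes>\<^bsub>MN\<^esub> b) g = (\<Oplus>\<^bsub>R\<^esub>p\<in>factor_pairs R G a b g. a (fst p) \<otimes>\<^bsub>R\<^esub> b (snd p))"
    using assms by (simp add: MN_ring_def)
  also have "\<dots> = (\<Oplus>\<^bsub>R\<^esub>p\<in>F. a (fst p) \<otimes>\<^bsub>R\<^esub> b (snd p))"
  proof (rule R.add.finprod_mono_neutral_cong_left)
    show "a (fst p) \<otimes>\<^bsub>R\<^esub> b (snd p) = \<zero>\<^bsub>R\<^esub>" if "p \<in> F - factor_pairs R G a b g" for p
    proof -
      have "fst p \<notin> supp a \<or> snd p \<notin> supp b"
        using that F by (auto simp: factor_pairs_def factorizations_def)
      then show ?thesis
        using that carrier[of p] assms MN_closed zero_outside_supp by fastforce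
    qed
  qed (use assms carrier MN_closed in auto)
  finally show ?thesis .
qed

text \<open>The freedom in choosing \<open>A\<close> and \<open>B\<close> is used below: unions of
  supports for distributivity, set products of supports for associativity.\<close>

lemma mult_apply:
  assumes a: "a \<in> carrier MN" and b: "b \<in> carrier MN" and "g \<in> carrier G"
    and A: "well_ordered_subset leq A" "supp a \<subseteq> A"
    and B: "well_ordered_subset leq B" "supp b \<subseteq> B"
  shows "(a \<otimes>\<^bsub>MN\<^esub> b) g = (\<Oplus>\<^bsub>R\<^esub>p\<in>factorizations A B g. a (fst p) \<otimes>\<^bsub>R\<^esub> b (snd p))"
proof (rule mult_apply_superset[OF assms(1-3)])
  show "finite (factorizations A B g)"
    using A B finite_factorizations by blast
  show "factorizations A B g \<subseteq> factorizations (carrier G) (carrier G) g"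
    using A B well_ordered_subset_carrier by (fastforce simp: factorizations_def)
  show "factor_pairs R G a b g \<subseteq> factorizations A B g"
    using A B by (auto simp: factor_pairs_def factorizations_def)
qed

lemma supp_mult_subset: "supp (a \<otimes>\<^bsub>MN\<^esub> b) \<subseteq> supp a <#> supp b"
proof
  fix g assume g: "g \<in> supp (a \<otimes>\<^bsub>MN\<^esub> b)"
  have "factor_pairs R G a b g \<noteq> {}"
    using g by (auto simp: series_support_def MN_ring_def)
  then show "g \<in> supp a <#> supp b"
    by (auto simp: factor_pairs_def set_mult_def)
qed

section \<open>Closure under the operations and the additive group\<close>

lemma mult_closed:
  assumes "a \<in> carrier MN" "b \<in> carrier MN"
  shows "a \<otimes>\<^bsub>MN\<^esub> b \<in> carrier MN"
proof (rule MN_memI)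
  show "a \<otimes>\<^bsub>MN\<^esub> b \<in> carrier G \<rightarrow>\<^sub>E carrier R"
    using assms MN_closed supp_carrier
    by (fastforce simp: MN_ring_def factor_pairs_def intro!: R.finsum_closed)
  show "well_ordered_subset leq (supp a <#> supp b)"
    using assms by (intro well_ordered_subset_set_mult supp_well_ordered)
  show "(a \<otimes>\<^bsub>MN\<^esub> b) g = \<zero>\<^bsub>R\<^esub>" if "g \<in> carrier G" "g \<notin> supp a <#> supp b" for g
    using that supp_mult_subset zero_outside_supp by blast
qed

lemma add_apply: "g \<in> carrier G \<Longrightarrow> (a \<oplus>\<^bsub>MN\<^esub> b) g = a g \<oplus>\<^bsub>R\<^esub> b g"
  by (simp add: MN_ring_def)

lemma zero_apply: "g \<in> carrier G \<Longrightarrow> \<zero>\<^bsub>MN\<^esub> g = \<zero>\<^bsub>R\<^esub>"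
  by (simp add: MN_ring_def)

lemma one_apply: "g \<in> carrier G \<Longrightarrow> \<one>\<^bsub>MN\<^esub> g = (if g = \<one> then \<one>\<^bsub>R\<^esub> else \<zero>\<^bsub>R\<^esub>)"
  by (simp add: MN_ring_def)

lemma add_closed:
  assumes "a \<in> carrier MN" "b \<in> carrier MN"
  shows "a \<oplus>\<^bsub>MN\<^esub> b \<in> carrier MN"
proof (rule MN_memI)
  show "a \<oplus>\<^bsub>MN\<^esub> b \<in> carrier G \<rightarrow>\<^sub>E carrier R"
    using assms MN_closed by (auto simp: MN_ring_def)
  show "well_ordered_subset leq (supp a \<union> supp b)"
    using assms by (intro well_ordered_subset_Un supp_well_ordered)
qed (auto simp: add_apply zero_outside_supp)

lemma zero_closed: "\<zero>\<^bsub>MN\<^esub> \<in> carrier MN"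
  by (rule MN_memI[OF _ well_ordered_subset_empty]) (auto simp: MN_ring_def)

lemma series_one_closed: "\<one>\<^bsub>MN\<^esub> \<in> carrier MN"
  by (rule MN_memI[OF _ well_ordered_subset_singleton[OF one_closed]]) (auto simp: MN_ring_def)

text \<open>This series is the witness for the additive inverse in
  \<open>abelian_group_MN\<close>.\<close>

lemma minus_closed:
  assumes "a \<in> carrier MN"
  shows "(\<lambda>g\<in>carrier G. \<ominus>\<^bsub>R\<^esub> a g) \<in> carrier MN"
  using assms MN_closed
  by (intro MN_memI[OF _ supp_well_ordered[OF assms]]) (auto simp: zero_outside_supp)

lemma abelian_group_MN: "abelian_group MN"
proof (rule abelian_groupI)
  show "\<exists>b\<in>carrier MN. b \<oplus>\<^bsub>MN\<^esub> a = \<zero>\<^bsub>MN\<^esub>" if "a \<in> carrier MN" for a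
  proof
    show "(\<lambda>g\<in>carrier G. \<ominus>\<^bsub>R\<^esub> a g) \<oplus>\<^bsub>MN\<^esub> a = \<zero>\<^bsub>MN\<^esub>"
      using that
      by (intro MN_eqI)
        (auto simp: add_apply zero_apply R.l_neg MN_closed intro: add_closed minus_closed zero_closed)
  qed (rule minus_closed[OF that])
qed (auto intro!: MN_eqI intro: add_closed zero_closed
    simp: add_apply zero_apply MN_closed add_closed R.a_ac)

section \<open>Associativity of multiplication\<close>

text \<open>Both coefficients at g are finite sums over the triples (x, y, z) of support elements
  with product g. The index sets \<open>?L\<close> and \<open>?R\<close> present these triples in
  the two bracketings.\<close>

lemma mult_assoc:
  assumes a: "a \<in> carrier MN" and b: "b \<in> carrier MN" and c: "c \<in> carrier MN"
  shows "(a \<otimes>\<^bsub>MN\<^esub> b) \<otimes>\<^bsub>MN\<^esub> c = a \<otimes>\<^bsub>MN\<^esub> (b \<otimes>\<^bsub>MN\<^esub> c)"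
proof (rule MN_eqI)
  fix g assume g: "g \<in> carrier G"
  let ?A = "supp a" and ?B = "supp b" and ?C = "supp c"
  let ?fz = factorizations
  note wo = a[THEN supp_well_ordered] b[THEN supp_well_ordered] c[THEN supp_well_ordered]
  \<comment> \<open>These set products contain the supports of the inner products and are
    well-ordered, so the outer sums may range over them and are finite.\<close>
  note wo2 = well_ordered_subset_set_mult[OF wo(1,2)] well_ordered_subset_set_mult[OF wo(2,3)]
  have A: "x \<in> carrier G \<and> a x \<in> carrier R" if "x \<in> ?A" for x
    using that supp_carrier MN_closed[OF a] by blast
  have B: "x \<in> carrier G \<and> b x \<in> carrier R" if "x \<in> ?B" for x
    using that supp_carrier MN_closed[OF b] by blast
  have C: "x \<in> carrier G \<and> c x \<in> carrier R" if "x \<in> ?C" for x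
    using that supp_carrier MN_closed[OF c] by blast
  let ?L = "Sigma (?fz (?A <#> ?B) ?C g) (\<lambda>p. ?fz ?A ?B (fst p))"
  let ?R = "Sigma (?fz ?A (?B <#> ?C) g) (\<lambda>p. ?fz ?B ?C (snd p))"
  \<comment> \<open>The map rebrackets a triple: k stands for the product of y and z and is dropped,
    while the product of x and y is formed. The summand \<open>?f\<close> reads x, y and z from the
    layout of \<open>?L\<close>.\<close>
  let ?h = "\<lambda>((x, k), (y, z)). ((x \<otimes> y, z), (x, y))"
  let ?f = "\<lambda>q. a (fst (snd q)) \<otimes>\<^bsub>R\<^esub> b (snd (snd q)) \<otimes>\<^bsub>R\<^esub> c (snd (fst q))"

  have "((a \<otimes>\<^bsub>MN\<^esub> b) \<otimes>\<^bsub>MN\<^esub> c) g =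
      (\<Oplus>\<^bsub>R\<^esub>p\<in>?fz (?A <#> ?B) ?C g. (a \<otimes>\<^bsub>MN\<^esub> b) (fst p) \<otimes>\<^bsub>R\<^esub> c (snd p))"
    using a b c g wo wo2 supp_mult_subset by (intro mult_apply mult_closed) auto
  also have "\<dots> = (\<Oplus>\<^bsub>R\<^esub>p\<in>?fz (?A <#> ?B) ?C g. \<Oplus>\<^bsub>R\<^esub>q\<in>?fz ?A ?B (fst p). ?f (p, q))"
  proof (rule R.finsum_cong')
    fix p assume p: "p \<in> ?fz (?A <#> ?B) ?C g"
    then have "fst p \<in> carrier G"
      using wo2 well_ordered_subset_carrier by (fastforce simp: factorizations_def)
    then have "(a \<otimes>\<^bsub>MN\<^esub> b) (fst p) = (\<Oplus>\<^bsub>R\<^esub>q\<in>?fz ?A ?B (fst p). a (fst q) \<otimes>\<^bsub>R\<^esub> b (snd q))"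
      using a b wo by (intro mult_apply) auto
    then show "(a \<otimes>\<^bsub>MN\<^esub> b) (fst p) \<otimes>\<^bsub>R\<^esub> c (snd p) = (\<Oplus>\<^bsub>R\<^esub>q\<in>?fz ?A ?B (fst p). ?f (p, q))"
      using p A B C finite_factorizations[OF wo(1,2)]
      by (auto simp: factorizations_def intro!: R.finsum_ldistr)
  qed (use A B C in \<open>auto simp: factorizations_def intro!: R.finsum_closed\<close>)
  also have "\<dots> = (\<Oplus>\<^bsub>R\<^esub>q\<in>?L. ?f q)"
    using A B C wo wo2 finite_factorizations
    by (subst R.finsum_Sigma) (auto simp: factorizations_def)
  also have "?L = ?h ` ?R"
  proof
    show "?L \<subseteq> ?h ` ?R"
    proof
      fix q assume "q \<in> ?L"
      then obtain x y z where q: "q = ((x \<otimes> y, z), (x, y))"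
        and xyz: "x \<in> ?A" "y \<in> ?B" "z \<in> ?C" "x \<otimes> y \<otimes> z = g"
        by (auto simp: factorizations_def)
      then have "((x, y \<otimes> z), (y, z)) \<in> ?R"
        using A B C m_assoc by (fastforce simp: factorizations_def set_mult_def)
      then show "q \<in> ?h ` ?R"
        unfolding q by force
    qed
    show "?h ` ?R \<subseteq> ?L"
      using A B C m_assoc by (fastforce simp: factorizations_def set_mult_def)
  qed
  \<comment> \<open>Reindexing is legitimate because on \<open>?R\<close> the dropped entry is
    recovered from y and z, which makes \<open>?h\<close> injective there.\<close>
  also have "(\<Oplus>\<^bsub>R\<^esub>q\<in>\<dots>. ?f q) = (\<Oplus>\<^bsub>R\<^esub>q\<in>?R. ?f (?h q))"
    using A B C by (intro R.finsum_reindex) (auto simp: factorizations_def inj_on_def)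
  also have "\<dots> = (\<Oplus>\<^bsub>R\<^esub>q\<in>?R. a (fst (fst q)) \<otimes>\<^bsub>R\<^esub> (b (fst (snd q)) \<otimes>\<^bsub>R\<^esub> c (snd (snd q))))"
    using A B C by (intro R.finsum_cong') (auto simp: factorizations_def R.m_assoc)
  also have "\<dots> = (\<Oplus>\<^bsub>R\<^esub>p\<in>?fz ?A (?B <#> ?C) g. \<Oplus>\<^bsub>R\<^esub>q\<in>?fz ?B ?C (snd p).
      a (fst p) \<otimes>\<^bsub>R\<^esub> (b (fst q) \<otimes>\<^bsub>R\<^esub> c (snd q)))"
    using A B C wo wo2 finite_factorizations
    by (subst R.finsum_Sigma) (auto simp: factorizations_def)
  also have "\<dots> = (\<Oplus>\<^bsub>R\<^esub>p\<in>?fz ?A (?B <#> ?C) g. a (fst p) \<otimes>\<^bsub>R\<^esub> (b \<otimes>\<^bsub>MN\<^esub> c) (snd p))"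
  proof (rule R.finsum_cong')
    fix p assume p: "p \<in> ?fz ?A (?B <#> ?C) g"
    then have "snd p \<in> carrier G"
      using wo2 well_ordered_subset_carrier by (fastforce simp: factorizations_def)
    then have "(b \<otimes>\<^bsub>MN\<^esub> c) (snd p) = (\<Oplus>\<^bsub>R\<^esub>q\<in>?fz ?B ?C (snd p). b (fst q) \<otimes>\<^bsub>R\<^esub> c (snd q))"
      using b c wo by (intro mult_apply) auto
    then show "(\<Oplus>\<^bsub>R\<^esub>q\<in>?fz ?B ?C (snd p). a (fst p) \<otimes>\<^bsub>R\<^esub> (b (fst q) \<otimes>\<^bsub>R\<^esub> c (snd q))) =
        a (fst p) \<otimes>\<^bsub>R\<^esub> (b \<otimes>\<^bsub>MN\<^esub> c) (snd p)"
      using p A B C finite_factorizations[OF wo(2,3)]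
      by (auto simp: factorizations_def intro!: R.finsum_rdistr[symmetric])
  next
    have "(b \<otimes>\<^bsub>MN\<^esub> c) x \<in> carrier R" if "x \<in> ?B <#> ?C" for x
      using that wo2 well_ordered_subset_carrier MN_closed mult_closed[OF b c] by blast
    then show "(\<lambda>p. a (fst p) \<otimes>\<^bsub>R\<^esub> (b \<otimes>\<^bsub>MN\<^esub> c) (snd p)) \<in> ?fz ?A (?B <#> ?C) g \<rightarrow> carrier R"
      using A by (auto simp: factorizations_def)
  qed simp
  also have "\<dots> = (a \<otimes>\<^bsub>MN\<^esub> (b \<otimes>\<^bsub>MN\<^esub> c)) g"
    using a b c g wo wo2 supp_mult_subset by (intro mult_apply[symmetric] mult_closed) auto
  finally show "((a \<otimes>\<^bsub>MN\<^esub> b) \<otimes>\<^bsub>MN\<^esub> c) g = (a \<otimes>\<^bsub>MN\<^esub> (b \<otimes>\<^bsub>MN\<^esub> c)) g" .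
qed (use assms in \<open>auto intro: mult_closed\<close>)

section \<open>Unit laws, distributivity and the ring\<close>

text \<open>Only an inclusion holds in general: over the zero ring the support is empty.\<close>

lemma supp_one_subset: "supp \<one>\<^bsub>MN\<^esub> \<subseteq> {\<one>}"
  by (auto simp: series_support_def one_apply split: if_splits)

lemma mult_one_left:
  assumes a: "a \<in> carrier MN"
  shows "\<one>\<^bsub>MN\<^esub> \<otimes>\<^bsub>MN\<^esub> a = a"
proof (rule MN_eqI)
  fix g assume g: "g \<in> carrier G"
  \<comment> \<open>The single pair need not be a factor pair, as \<open>a g\<close> may be zero;
    \<open>mult_apply_superset\<close> covers both cases.\<close>
  have "factor_pairs R G \<one>\<^bsub>MN\<^esub> a g \<subseteq> {(\<one>, g)}"
    using supp_one_subset supp_carrier by (fastforce simp: factor_pairs_def)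
  then have "(\<one>\<^bsub>MN\<^esub> \<otimes>\<^bsub>MN\<^esub> a) g = (\<Oplus>\<^bsub>R\<^esub>p\<in>{(\<one>, g)}. \<one>\<^bsub>MN\<^esub> (fst p) \<otimes>\<^bsub>R\<^esub> a (snd p))"
    using a g by (intro mult_apply_superset series_one_closed) (auto simp: factorizations_def)
  then show "(\<one>\<^bsub>MN\<^esub> \<otimes>\<^bsub>MN\<^esub> a) g = a g"
    using a g by (simp add: one_apply MN_closed)
qed (use a in \<open>auto intro: mult_closed series_one_closed\<close>)

lemma mult_one_right:
  assumes a: "a \<in> carrier MN"
  shows "a \<otimes>\<^bsub>MN\<^esub> \<one>\<^bsub>MN\<^esub> = a"
proof (rule MN_eqI)
  fix g assume g: "g \<in> carrier G"
  have "factor_pairs R G a \<one>\<^bsub>MN\<^esub> g \<subseteq> {(g, \<one>)}"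
    using supp_one_subset supp_carrier by (fastforce simp: factor_pairs_def)
  then have "(a \<otimes>\<^bsub>MN\<^esub> \<one>\<^bsub>MN\<^esub>) g = (\<Oplus>\<^bsub>R\<^esub>p\<in>{(g, \<one>)}. a (fst p) \<otimes>\<^bsub>R\<^esub> \<one>\<^bsub>MN\<^esub> (snd p))"
    using a g by (intro mult_apply_superset series_one_closed) (auto simp: factorizations_def)
  then show "(a \<otimes>\<^bsub>MN\<^esub> \<one>\<^bsub>MN\<^esub>) g = a g"
    using a g by (simp add: one_apply MN_closed)
qed (use a in \<open>auto intro: mult_closed series_one_closed\<close>)

lemma supp_add_subset: "supp (a \<oplus>\<^bsub>MN\<^esub> b) \<subseteq> supp a \<union> supp b"
  by (auto simp: series_support_def add_apply)

text \<open>The three products involved are all expanded over the same finite set \<open>?F\<close>,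
  built from the union of the supports of a and b; the identity then holds term by term.\<close>

lemma distrib_right:
  assumes a: "a \<in> carrier MN" and b: "b \<in> carrier MN" and c: "c \<in> carrier MN"
  shows "(a \<oplus>\<^bsub>MN\<^esub> b) \<otimes>\<^bsub>MN\<^esub> c = a \<otimes>\<^bsub>MN\<^esub> c \<oplus>\<^bsub>MN\<^esub> b \<otimes>\<^bsub>MN\<^esub> c"
proof (rule MN_eqI)
  fix g assume g: "g \<in> carrier G"
  let ?F = "factorizations (supp a \<union> supp b) (supp c) g"
  note wo = well_ordered_subset_Un[OF a[THEN supp_well_ordered] b[THEN supp_well_ordered]]
    c[THEN supp_well_ordered]
  have carrier: "fst p \<in> carrier G \<and> snd p \<in> carrier G" if "p \<in> ?F" for p
    using that supp_carrier by (fastforce simp: factorizations_def)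
  have "((a \<oplus>\<^bsub>MN\<^esub> b) \<otimes>\<^bsub>MN\<^esub> c) g = (\<Oplus>\<^bsub>R\<^esub>p\<in>?F. (a \<oplus>\<^bsub>MN\<^esub> b) (fst p) \<otimes>\<^bsub>R\<^esub> c (snd p))"
    using a b c g wo supp_add_subset by (intro mult_apply add_closed) auto
  also have "\<dots> = (\<Oplus>\<^bsub>R\<^esub>p\<in>?F. a (fst p) \<otimes>\<^bsub>R\<^esub> c (snd p) \<oplus>\<^bsub>R\<^esub> b (fst p) \<otimes>\<^bsub>R\<^esub> c (snd p))"
    using a b c carrier by (intro R.finsum_cong') (auto simp: add_apply R.l_distr MN_closed)
  also have "\<dots> = (\<Oplus>\<^bsub>R\<^esub>p\<in>?F. a (fst p) \<otimes>\<^bsub>R\<^esub> c (snd p)) \<oplus>\<^bsub>R\<^esub> (\<Oplus>\<^bsub>R\<^esub>p\<in>?F. b (fst p) \<otimes>\<^bsub>R\<^esub> c (snd p))"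
    using a b c carrier by (intro R.finsum_addf) (auto simp: MN_closed)
  also have "(\<Oplus>\<^bsub>R\<^esub>p\<in>?F. a (fst p) \<otimes>\<^bsub>R\<^esub> c (snd p)) = (a \<otimes>\<^bsub>MN\<^esub> c) g"
    using a c g wo by (intro mult_apply[symmetric]) auto
  also have "(\<Oplus>\<^bsub>R\<^esub>p\<in>?F. b (fst p) \<otimes>\<^bsub>R\<^esub> c (snd p)) = (b \<otimes>\<^bsub>MN\<^esub> c) g"
    using b c g wo by (intro mult_apply[symmetric]) auto
  finally show "((a \<oplus>\<^bsub>MN\<^esub> b) \<otimes>\<^bsub>MN\<^esub> c) g = (a \<otimes>\<^bsub>MN\<^esub> c \<oplus>\<^bsub>MN\<^esub> b \<otimes>\<^bsub>MN\<^esub> c) g"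
    using g by (simp add: add_apply)
qed (use assms in \<open>auto intro: mult_closed add_closed\<close>)

text \<open>As G may be noncommutative, the mirror image of the preceding argument is carried out
  separately.\<close>

lemma distrib_left:
  assumes a: "a \<in> carrier MN" and b: "b \<in> carrier MN" and c: "c \<in> carrier MN"
  shows "c \<otimes>\<^bsub>MN\<^esub> (a \<oplus>\<^bsub>MN\<^esub> b) = c \<otimes>\<^bsub>MN\<^esub> a \<oplus>\<^bsub>MN\<^esub> c \<otimes>\<^bsub>MN\<^esub> b"
proof (rule MN_eqI)
  fix g assume g: "g \<in> carrier G"
  let ?F = "factorizations (supp c) (supp a \<union> supp b) g"
  note wo = well_ordered_subset_Un[OF a[THEN supp_well_ordered] b[THEN supp_well_ordered]]
    c[THEN supp_well_ordered]
  have carrier: "fst p \<in> carrier G \<and> snd p \<in> carrier G" if "p \<in> ?F" for p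
    using that supp_carrier by (fastforce simp: factorizations_def)
  have "(c \<otimes>\<^bsub>MN\<^esub> (a \<oplus>\<^bsub>MN\<^esub> b)) g = (\<Oplus>\<^bsub>R\<^esub>p\<in>?F. c (fst p) \<otimes>\<^bsub>R\<^esub> (a \<oplus>\<^bsub>MN\<^esub> b) (snd p))"
    using a b c g wo supp_add_subset by (intro mult_apply add_closed) auto
  also have "\<dots> = (\<Oplus>\<^bsub>R\<^esub>p\<in>?F. c (fst p) \<otimes>\<^bsub>R\<^esub> a (snd p) \<oplus>\<^bsub>R\<^esub> c (fst p) \<otimes>\<^bsub>R\<^esub> b (snd p))"
    using a b c carrier by (intro R.finsum_cong') (auto simp: add_apply R.r_distr MN_closed)
  also have "\<dots> = (\<Oplus>\<^bsub>R\<^esub>p\<in>?F. c (fst p) \<otimes>\<^bsub>R\<^esub> a (snd p)) \<oplus>\<^bsub>R\<^esub> (\<Oplus>\<^bsub>R\<^esub>p\<in>?F. c (fst p) \<otimes>\<^bsub>R\<^esub> b (snd p))"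
    using a b c carrier by (intro R.finsum_addf) (auto simp: MN_closed)
  also have "(\<Oplus>\<^bsub>R\<^esub>p\<in>?F. c (fst p) \<otimes>\<^bsub>R\<^esub> a (snd p)) = (c \<otimes>\<^bsub>MN\<^esub> a) g"
    using a c g wo by (intro mult_apply[symmetric]) auto
  also have "(\<Oplus>\<^bsub>R\<^esub>p\<in>?F. c (fst p) \<otimes>\<^bsub>R\<^esub> b (snd p)) = (c \<otimes>\<^bsub>MN\<^esub> b) g"
    using b c g wo by (intro mult_apply[symmetric]) auto
  finally show "(c \<otimes>\<^bsub>MN\<^esub> (a \<oplus>\<^bsub>MN\<^esub> b)) g = (c \<otimes>\<^bsub>MN\<^esub> a \<oplus>\<^bsub>MN\<^esub> c \<otimes>\<^bsub>MN\<^esub> b) g"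
    using g by (simp add: add_apply)
qed (use assms in \<open>auto intro: mult_closed add_closed\<close>)

lemma ring_MN: "ring MN"
proof (rule ringI)
  show "monoid MN"
    by (rule monoidI) (simp_all add: mult_closed series_one_closed mult_assoc mult_one_left mult_one_right)
qed (simp_all add: abelian_group_MN distrib_right distrib_left)

end

text \<open>The finiteness clause ensures that each coefficient of a product is a genuine finite sum
  rather than the default value of \<open>finsum\<close>, so the ring in the second clause carries
  the intended multiplication.\<close>

theorem mainTheorem13:
  fixes R :: "('r, 'k) ring_scheme" and G :: "('g, 'm) monoid_scheme" and leq :: "'g rel"
  assumes "cring R" and "totally_ordered_monoid G leq"
  shows "(\<forall>a\<in>MN_series R G leq. \<forall>b\<in>MN_series R G leq. \<forall>g\<in>carrier G.
            finite (factor_pairs R G a b g)) \<and>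
         ring (MN_ring R G leq)"
proof -
  interpret malcev_neumann R G leq
    using assms by (simp add: malcev_neumann_def cring_def)
  show ?thesis
    using finite_factor_pairs ring_MN by (simp add: carrier_MN)
qed

end
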